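(* Fix a (symmetric) positive definite $k\times k$ matrix $A\mathcal{S}_{t-1}$, known given $\mathcal{F}_{t-1}$, and let $\phi_{\mathrm{SD}}$ be the score-driven rule with $\Delta\phi_{\mathrm{SD}}(y,\vartheta_{t|t-1})=A\mathcal{S}_{t-1}\,s(y,\vartheta_{t|t-1})$. Assume: $\Theta\subseteq\mathbb{R}^k$ is open and convex, $\vartheta_{t|t-1}\in\Theta$ and the updated parameter lies in $\Theta$ (almost surely); $\log f(x|\vartheta)$ is twice continuously differentiable in $\vartheta$ for all $\vartheta\in\Theta$ and $x\in\mathcal{Y}$; and $\mathbb{E}_{p_t}[s(X_t,\vartheta_{t|t-1})]$ and $\mathbb{E}_{p_t}[\|\Delta\phi_{\mathrm{SD}}(Y_t,\vartheta_{t|t-1})\|^2]$ are finite for all $\vartheta_{t|t-1}\in\Theta$ and $p_t\in\mathcal{P}$. Moreover, let (i) $\mu_{p_t}:=\mathbb{E}_{p_t}[s(Y_t,\vartheta_{t|t-1})]\neq 0$, and (ii) $\operatorname{tr}(\Sigma_{p_t})<\infty$, where $\Sigma_{p_t}:=\mathbb{E}_{p_t}[s(Y_t,\vartheta_{t|t-1})s(Y_t,\vartheta_{t|t-1})^\top]-\mu_{p_t}\mu_{p_t}^\top$. If the constant $d>0$ is sufficiently large such that $$\mathbb{P}_{p_t}\big(\|A\mathcal{S}_{t-1}\,s(Y_t,\vartheta_{t|t-1})\|>d\big)\;<\;\frac{\|\mu_{p_t}\|_{A\mathcal{S}_{t-1}}^2}{\|\mu_{p_t}\|_{A\mathcal{S}_{t-1}}^2+\operatorname{tr}(A\mathcal{S}_{t-1}\Sigma_{p_t})},\qquad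 \|\mu_{p_t}\|_{A\mathcal{S}_{t-1}}^2:=\mu_{p_t}^\top A\mathcal{S}_{t-1}\mu_{p_t},$$ then the clipped score-driven update $$\Delta\phi^d_{\mathrm{CSD}}(Y_t,\vartheta_{t|t-1}):=\min\Big\{1,\frac{d}{\|\Delta\phi_{\mathrm{SD}}(Y_t,\vartheta_{t|t-1})\|}\Big\}\,\Delta\phi_{\mathrm{SD}}(Y_t,\vartheta_{t|t-1}),\qquad 1/0:=\infty,$$ satisfies $$\mathbb{E}_{p_t}\big[\Delta\phi^d_{\mathrm{CSD}}(Y_t,\vartheta_{t|t-1})\big]^\top\,\mathbb{E}_{p_t}\big[s(X_t,\vartheta_{t|t-1})\big]>0.$$
   Context: Let $\mathcal{Y}\subseteq\mathbb{R}^l$ be the outcome space and fix a time $t$. Conditionally on the information set $\mathcal{F}_{t-1}$ at time $t-1$, the observation $Y_t$ has true density $p_t$ on $\mathcal{Y}$, belonging to a class $\mathcal{P}$ of absolutely continuous distributions. Quantities known given $\mathcal{F}_{t-1}$, such as the predicted parameter $\vartheta_{t|t-1}\in\Theta$ and the matrices $A$ and $\mathcal{S}_{t-1}$, are treated as fixed. $\mathbb{E}_{p_t}$ and $\mathbb{P}_{p_t}$ denote expectation and probability under $p_t$, and $X_t$ denotes an independent copy of $Y_t$. The postulated (possibly misspecified) model is a family of densities $f(\cdot|\vartheta)$, $\vartheta\in\Theta\subseteq\mathbb{R}^k$; the support of $p_t$ is contained in the support of $f(\cdot|\vartheta)$ for all $\vartheta\in\Theta$. The score is $s(y,\vartheta)=\frac{\partial}{\partial\vartheta}\log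 f(y|\vartheta)$. For an updating rule $\phi:\mathcal{Y}\times\Theta\to\Theta$, the updated parameter is $\phi(y,\vartheta_{t|t-1})$ and $\Delta\phi(y,\vartheta_{t|t-1}):=\phi(y,\vartheta_{t|t-1})-\vartheta_{t|t-1}$. $\|\cdot\|$ is the Euclidean norm and $\operatorname{tr}$ the trace. *)

theory Defs
  imports "HOL-Probability.Probability"
begin

text \<open>Probability densities with respect to Lebesgue measure on an outcome space
  \<open>Y \<subseteq> \<real>\<^sup>l\<close>, represented as functions on the whole space that vanish outside \<open>Y\<close>.\<close>

definition law :: "(real ^ 'l \<Rightarrow> real) \<Rightarrow> (real ^ 'l) measure" where
  "law p = density lborel (\<lambda>y. ennreal (p y))"

definition density_on :: "(real ^ 'l) set \<Rightarrow> (real ^ 'l \<Rightarrow> real) \<Rightarrow> bool" where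
  "density_on Y p \<longleftrightarrow>
     p \<in> borel_measurable borel \<and> (\<forall>y. 0 \<le> p y) \<and> (\<forall>y. y \<notin> Y \<longrightarrow> p y = 0) \<and>
     prob_space (law p)"

definition density_support :: "(real ^ 'l \<Rightarrow> real) \<Rightarrow> (real ^ 'l) set" where
  "density_support p = {y. p y > 0}"

definition pos_def_matrix :: "real ^ 'k ^ 'k \<Rightarrow> bool" where
  "pos_def_matrix M \<longleftrightarrow> transpose M = M \<and> (\<forall>x. x \<noteq> 0 \<longrightarrow> 0 < x \<bullet> (M *v x))"

definition outer :: "real ^ 'k \<Rightarrow> real ^ 'k \<Rightarrow> real ^ 'k ^ 'k" where
  "outer v w = (\<chi> i j. v $ i * w $ j)"

text \<open>\<open>G\<close> is the gradient and \<open>H\<close> the Hessian matrix of \<open>F\<close>. The set is meant to be open.\<close>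

definition C2_on :: "(real ^ 'k) set \<Rightarrow> (real ^ 'k \<Rightarrow> real) \<Rightarrow> bool" where
  "C2_on T F \<longleftrightarrow>
     (\<exists>(G :: real ^ 'k \<Rightarrow> real ^ 'k) (H :: real ^ 'k \<Rightarrow> real ^ 'k ^ 'k).
        (\<forall>\<theta>\<in>T. GDERIV F \<theta> :> G \<theta>) \<and>
        (\<forall>\<theta>\<in>T. (G has_derivative (\<lambda>h. H \<theta> *v h)) (at \<theta>)) \<and>
        continuous_on T H)"

text \<open>Here \<open>f y \<theta>\<close> is the model density \<open>f(y|\<theta>)\<close>.\<close>

definition score :: "(real ^ 'l \<Rightarrow> real ^ 'k \<Rightarrow> real) \<Rightarrow> real ^ 'l \<Rightarrow> real ^ 'k \<Rightarrow> real ^ 'k" where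
  "score f y \<theta> = (THE D. GDERIV (\<lambda>\<eta>. ln (f y \<eta>)) \<theta> :> D)"

definition increment ::
    "(real ^ 'l \<Rightarrow> real ^ 'k \<Rightarrow> real ^ 'k) \<Rightarrow> real ^ 'l \<Rightarrow> real ^ 'k \<Rightarrow> real ^ 'k" where
  "increment \<phi> y \<theta> = \<phi> y \<theta> - \<theta>"

definition sd_rule ::
    "real ^ 'k ^ 'k \<Rightarrow> (real ^ 'l \<Rightarrow> real ^ 'k \<Rightarrow> real) \<Rightarrow> real ^ 'l \<Rightarrow> real ^ 'k \<Rightarrow> real ^ 'k" where
  "sd_rule M f y \<theta> = \<theta> + M *v score f y \<theta>"

text \<open>The case distinction implements the convention \<open>1/0 = \<infinity>\<close>
  (in HOL, \<open>d / 0 = 0\<close>).\<close>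

definition clip :: "real \<Rightarrow> real ^ 'k \<Rightarrow> real ^ 'k" where
  "clip d v = (if norm v = 0 then 1 else min 1 (d / norm v)) *\<^sub>R v"

definition csd_rule ::
    "real \<Rightarrow> real ^ 'k ^ 'k \<Rightarrow> (real ^ 'l \<Rightarrow> real ^ 'k \<Rightarrow> real) \<Rightarrow>
       real ^ 'l \<Rightarrow> real ^ 'k \<Rightarrow> real ^ 'k" where
  "csd_rule d M f y \<theta> = \<theta> + clip d (increment (sd_rule M f) y \<theta>)"

definition score_mean ::
    "(real ^ 'l \<Rightarrow> real ^ 'k \<Rightarrow> real) \<Rightarrow> (real ^ 'l \<Rightarrow> real) \<Rightarrow> real ^ 'k \<Rightarrow> real ^ 'k" where
  "score_mean f p \<theta> = (LINT y|law p. score f y \<theta>)"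

definition score_cov ::
    "(real ^ 'l \<Rightarrow> real ^ 'k \<Rightarrow> real) \<Rightarrow> (real ^ 'l \<Rightarrow> real) \<Rightarrow> real ^ 'k \<Rightarrow> real ^ 'k ^ 'k" where
  "score_cov f p \<theta> =
     (LINT y|law p. outer (score f y \<theta>) (score f y \<theta>)) -
     outer (score_mean f p \<theta>) (score_mean f p \<theta>)"

text \<open>The trace of the covariance matrix as an extended real. A Bochner integral is always
  a real number (it is 0 for non-integrable functions), so finiteness of
  \<open>trace (score_cov f p \<theta>)\<close> would be no condition; the diagonal entries
  \<open>E[s\<^sub>i s\<^sub>i] - \<mu>\<^sub>i \<mu>\<^sub>i\<close> are therefore formed with the nonnegative Lebesgue integral.\<close>

definition score_cov_trace ::
    "(real ^ 'l \<Rightarrow> real ^ 'k \<Rightarrow> real) \<Rightarrow> (real ^ 'l \<Rightarrow> real) \<Rightarrow> real ^ 'k \<Rightarrow> ereal" where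
  "score_cov_trace f p \<theta> =
     (\<Sum>i\<in>UNIV.
        enn2ereal (\<integral>\<^sup>+ y. ennreal (score f y \<theta> $ i * score f y \<theta> $ i) \<partial>law p) -
        ereal (score_mean f p \<theta> $ i * score_mean f p \<theta> $ i))"

definition sq_norm_wrt :: "real ^ 'k ^ 'k \<Rightarrow> real ^ 'k \<Rightarrow> real" where
  "sq_norm_wrt M v = v \<bullet> (M *v v)"

end

theory Submission
  imports Defs
begin

text \<open>Write \<open>M\<close> for the matrix \<open>A S\<close>, \<open>s\<close> for the score, \<open>\<mu>\<close> for its mean,
  \<open>Q v = v \<bullet> M v\<close>, and \<open>c \<in> [0, 1]\<close> for the clipping factor. Since \<open>M\<close> is symmetric, the
  claim says that \<open>E[c Z] > 0\<close> for \<open>Z = \<mu> \<bullet> M s\<close>, whereas without clipping \<open>E Z = Q \<mu> > 0\<close>.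
  The loss \<open>(1 - c) Z\<close> is confined to the event \<open>B\<close> that \<open>norm (M s) > d\<close>. Expanding
  \<open>Q (t \<mu> - s) \<ge> 0\<close> gives \<open>2 Z \<le> t Q \<mu> + Q s / t\<close> for every \<open>t > 0\<close>, hence
  \<open>E[(1 - c) Z] \<le> (t Q \<mu> P(B) + E[Q s] / t) / 2\<close>.

  The second moment splits into mean and covariance, \<open>b := E[Q s] = Q \<mu> + trace (M \<Sigma>)\<close>
  (\<open>expectation_quadratic_form\<close>). With the choice \<open>t = b / Q \<mu>\<close> the bound on the loss becomes
  \<open>(b P(B) + Q \<mu>) / 2\<close>, and the hypothesis on \<open>d\<close> says exactly that \<open>b P(B) < Q \<mu>\<close>. So the
  loss is smaller than \<open>E Z\<close> (\<open>clipped_mean_inner_pos\<close>). This choice of \<open>t\<close> makes the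
  argument as sharp as the Cauchy--Schwarz inequality in the norm induced by \<open>M\<close> together with
  the one for expectations.

  Square integrability of \<open>s\<close> itself follows from that of \<open>M s\<close> because an invertible linear
  map on a finite-dimensional space is bounded below.\<close>

section \<open>Quadratic forms and outer products\<close>

lemma trace_mult_outer: "trace (M ** outer v w) = w \<bullet> (M *v v)"
  by (simp add: trace_def matrix_matrix_mult_def matrix_vector_mult_def outer_def inner_vec_def
      sum_distrib_left mult_ac)

lemma norm_outer: "norm (outer v w) = norm v * norm w"
proof -
  have "outer v w $ i = v $ i *\<^sub>R w" for i
    by (simp add: outer_def vec_eq_iff)
  then have "norm (outer v w) = L2_set (\<lambda>i. \<bar>v $ i\<bar> * norm w) UNIV"
    by (simp add: norm_vec_def[of "outer v w"])
  also have "\<dots> = L2_set (\<lambda>i. norm (v $ i)) UNIV * norm w"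
    by (subst L2_set_left_distrib) simp_all
  finally show ?thesis
    by (simp add: norm_vec_def[of v])
qed

lemma continuous_on_outer_self: "continuous_on UNIV (\<lambda>v. outer v v)"
  unfolding outer_def by (intro continuous_intros)

lemma bounded_linear_trace_mult: "bounded_linear (\<lambda>X :: real ^ 'n ^ 'n. trace (M ** X))"
  by (unfold linear_conv_bounded_linear[symmetric], intro linearI)
     (simp_all add: matrix_add_ldistrib scalar_matrix_assoc[symmetric]
        matrix_scalar_ac trace_def sum_distrib_left sum.distrib)

lemma symmetric_matrix_inner:
  fixes M :: "real ^ 'n ^ 'n"
  assumes "transpose M = M"
  shows "(M *v v) \<bullet> w = v \<bullet> (M *v w)"
  using assms by (metis dot_lmul_matrix transpose_matrix_vector)

lemma pos_def_matrix_nonneg: "pos_def_matrix M \<Longrightarrow> 0 \<le> sq_norm_wrt M v"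
  unfolding pos_def_matrix_def sq_norm_wrt_def
  by (cases "v = 0") (auto intro: less_imp_le)

text \<open>Young's inequality for the inner product given by \<open>M\<close>; its free parameter replaces the
  square roots of the Cauchy--Schwarz inequality.\<close>

lemma pos_def_young:
  assumes "pos_def_matrix M" and "t > 0"
  shows "2 * (w \<bullet> (M *v v)) \<le> t * sq_norm_wrt M w + sq_norm_wrt M v / t"
proof -
  have sym: "v \<bullet> (M *v w) = w \<bullet> (M *v v)"
    using assms(1) symmetric_matrix_inner[of M w v]
    by (simp add: pos_def_matrix_def inner_commute)
  have "0 \<le> sq_norm_wrt M (t *\<^sub>R w - v)"
    using assms(1) by (rule pos_def_matrix_nonneg)
  also have "\<dots> = t * (t * sq_norm_wrt M w - 2 * (w \<bullet> (M *v v)) + sq_norm_wrt M v / t)"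
    using assms(2) sym
    by (simp add: sq_norm_wrt_def matrix_vector_mult_diff_distrib matrix_vector_mult_scaleR
        inner_diff_left inner_diff_right field_simps)
  finally show ?thesis
    using assms(2) by (simp add: zero_le_mult_iff)
qed

lemma pos_def_bounded_below:
  fixes M :: "real ^ 'n ^ 'n"
  assumes "pos_def_matrix M"
  obtains B where "B > 0" "\<And>v. B * norm v \<le> norm (M *v v)"
proof -
  have "v = 0" if "M *v v = 0" for v
    using that assms by (force simp: pos_def_matrix_def)
  then have "inj ((*v) M)"
    by (simp add: linear_injective_0)
  then show ?thesis
    using linear_inj_bounded_below_pos[of "(*v) M"] that by auto
qed

section \<open>Second moments of random vectors\<close>

lemma integrable_outer_self:
  assumes "X \<in> borel_measurable N" and "integrable N (\<lambda>x. (norm (X x))\<^sup>2)"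
  shows "integrable N (\<lambda>x. outer (X x) (X x))"
proof (rule Bochner_Integration.integrable_bound[OF assms(2)])
  show "(\<lambda>x. outer (X x) (X x)) \<in> borel_measurable N"
    using borel_measurable_continuous_on[OF continuous_on_outer_self assms(1)] .
qed (simp add: norm_outer power2_eq_square)

text \<open>The quadratic form is linear in the outer product, \<open>Q v = trace (M v v\<^sup>T)\<close>, so that
  expectation and trace may be interchanged. With the mean of \<open>X\<close> as \<open>m\<close>, the last trace is that
  of \<open>M\<close> times the covariance matrix.\<close>

lemma expectation_quadratic_form:
  assumes "X \<in> borel_measurable N" and "integrable N (\<lambda>x. (norm (X x))\<^sup>2)"
  shows "integrable N (\<lambda>x. sq_norm_wrt M (X x))"
    and "(LINT x|N. sq_norm_wrt M (X x)) =
      sq_norm_wrt M m + trace (M ** ((LINT x|N. outer (X x) (X x)) - outer m m))"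
proof -
  note lin = bounded_linear_trace_mult[of M]
  have Q: "sq_norm_wrt M v = trace (M ** outer v v)" for v
    by (simp add: sq_norm_wrt_def trace_mult_outer)
  note int = integrable_outer_self[OF assms]
  show "integrable N (\<lambda>x. sq_norm_wrt M (X x))"
    unfolding Q by (rule integrable_bounded_linear[OF lin int])
  show "(LINT x|N. sq_norm_wrt M (X x)) =
      sq_norm_wrt M m + trace (M ** ((LINT x|N. outer (X x) (X x)) - outer m m))"
    unfolding Q integral_bounded_linear[OF lin int]
    by (simp add: linear_diff[OF bounded_linear.linear[OF lin]])
qed

section \<open>Clipping\<close>

definition clip_factor :: "real \<Rightarrow> real ^ 'n \<Rightarrow> real" where
  "clip_factor d v = (if norm v = 0 then 1 else min 1 (d / norm v))"

lemma clip_eq_clip_factor: "clip d v = clip_factor d v *\<^sub>R v"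
  by (simp add: clip_def clip_factor_def)

lemma clip_factor_bounds:
  assumes "d > 0"
  shows "0 \<le> clip_factor d v" and "clip_factor d v \<le> 1"
  using assms by (auto simp: clip_factor_def)

lemma clip_factor_eq_1: "norm v \<le> d \<Longrightarrow> clip_factor d v = 1"
  by (auto simp: clip_factor_def field_simps)

lemma borel_measurable_clip_factor [measurable]: "clip_factor d \<in> borel_measurable borel"
  unfolding clip_factor_def by measurable

text \<open>The loss \<open>(1 - c) Z\<close> is at most the Young bound on the clipping event and vanishes off it.
  The indicator is kept only on the constant term: this is what turns the probability of
  clipping into the quantity to be controlled, while \<open>Q v / t\<close> is allowed its full
  expectation.\<close>

lemma clip_loss_bound:
  assumes M: "pos_def_matrix M" and d: "d > 0" and t: "t > 0"
  shows "w \<bullet> (M *v v) - clip d (M *v v) \<bullet> w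
    \<le> (t * sq_norm_wrt M w * indicator {v. norm (M *v v) > d} v + sq_norm_wrt M v / t) / 2"
proof -
  define c where "c = clip_factor d (M *v v)"
  have loss: "w \<bullet> (M *v v) - clip d (M *v v) \<bullet> w = (1 - c) * (w \<bullet> (M *v v))"
    by (simp add: clip_eq_clip_factor c_def inner_commute algebra_simps)
  show ?thesis
  proof (cases "norm (M *v v) > d")
    case True
    let ?b = "(t * sq_norm_wrt M w + sq_norm_wrt M v / t) / 2"
    have "0 \<le> ?b"
      using pos_def_matrix_nonneg[OF M] t by simp
    moreover have "w \<bullet> (M *v v) \<le> ?b"
      using pos_def_young[OF M t, of w v] by simp
    moreover have "0 \<le> 1 - c" "1 - c \<le> 1"
      using clip_factor_bounds[OF d] by (simp_all add: c_def)
    ultimately have "(1 - c) * (w \<bullet> (M *v v)) \<le> ?b"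
      by (meson mult_left_mono mult_left_le_one_le order_trans)
    then show ?thesis
      unfolding loss using True by simp
  next
    case False
    then have "c = 1"
      by (simp add: c_def clip_factor_eq_1)
    then show ?thesis
      unfolding loss using False pos_def_matrix_nonneg[OF M, of v] t by simp
  qed
qed

lemma integrable_clip:
  assumes "integrable N X" and "d > 0"
  shows "integrable N (\<lambda>x. clip d (X x))"
proof (rule Bochner_Integration.integrable_bound[OF assms(1)])
  have [measurable]: "X \<in> borel_measurable N"
    using assms(1) by simp
  show "(\<lambda>x. clip d (X x)) \<in> borel_measurable N"
    unfolding clip_eq_clip_factor by measurable
  show "AE x in N. norm (clip d (X x)) \<le> norm (X x)"
  proof (rule AE_I2)
    show "norm (clip d (X x)) \<le> norm (X x)" for x
      using clip_factor_bounds[OF assms(2), of "X x"]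
      by (simp add: clip_eq_clip_factor mult_left_le_one_le)
  qed
qed

section \<open>Positive alignment of the clipped mean\<close>

lemma clipped_mean_inner_pos:
  fixes X :: "'a \<Rightarrow> real ^ 'n" and M :: "real ^ 'n ^ 'n"
  assumes "prob_space N" and M: "pos_def_matrix M" and d: "d > 0"
    and X: "integrable N X" and X2: "integrable N (\<lambda>x. (norm (X x))\<^sup>2)"
    and mu: "\<mu> = (LINT x|N. X x)" "\<mu> \<noteq> 0"
    and prob: "measure N {x \<in> space N. norm (M *v X x) > d}
      < sq_norm_wrt M \<mu> / (LINT x|N. sq_norm_wrt M (X x))"
  shows "(LINT x|N. clip d (M *v X x)) \<bullet> \<mu> > 0"
proof -
  interpret prob_space N by fact
  let ?B = "{x \<in> space N. norm (M *v X x) > d}"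
  have meas [measurable]: "X \<in> borel_measurable N"
    using X by simp
  have lin: "bounded_linear ((*v) M)"
    by (simp add: linear_conv_bounded_linear[symmetric])
  have MX: "integrable N (\<lambda>x. M *v X x)" "(LINT x|N. M *v X x) = M *v \<mu>"
    using integrable_bounded_linear[OF lin X] integral_bounded_linear[OF lin X] mu by simp_all
  note Q = expectation_quadratic_form(1)[OF meas X2, of M]
  have [measurable]: "(\<lambda>x. M *v X x) \<in> borel_measurable N"
    using MX(1) by simp
  have B: "?B \<in> sets N"
    by measurable
  define a where "a = sq_norm_wrt M \<mu>"
  define b where "b = (LINT x|N. sq_norm_wrt M (X x))"
  have a: "a > 0"
    using M mu(2) by (simp add: a_def pos_def_matrix_def sq_norm_wrt_def)
  \<comment> \<open>A probability lies below the quotient \<open>a / b\<close>, so its denominator is positive.\<close>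
  have "0 < a / b"
    using prob measure_nonneg[of N ?B] unfolding a_def b_def by linarith
  then have b: "b > 0"
    using a by (simp add: zero_less_divide_iff)
  have small: "measure N ?B * b < a"
    using prob b by (simp add: a_def b_def pos_less_divide_eq)
  \<comment> \<open>The value of \<open>t\<close> for which the two halves of the Young bound, \<open>t a\<close> times \<open>P(B)\<close> and
    \<open>b / t\<close>, balance in the critical case \<open>b P(B) = a\<close>.\<close>
  define t where "t = b / a"
  have t: "t > 0"
    using a b by (simp add: t_def)
  have int_Z: "integrable N (\<lambda>x. \<mu> \<bullet> (M *v X x))"
    using MX(1) by simp
  note clip_int = integrable_clip[OF MX(1) d]
  have int_c: "integrable N (\<lambda>x. clip d (M *v X x) \<bullet> \<mu>)"
    using clip_int by simp
  have int_B: "integrable N (indicator ?B :: 'a \<Rightarrow> real)"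
    using B by (intro integrable_real_indicator) (simp_all add: less_top[symmetric])
  have "a - (LINT x|N. clip d (M *v X x)) \<bullet> \<mu>
      = (LINT x|N. \<mu> \<bullet> (M *v X x) - clip d (M *v X x) \<bullet> \<mu>)"
    using int_Z int_c MX clip_int by (simp add: a_def sq_norm_wrt_def)
  also have "\<dots> \<le> (LINT x|N. (t * a * indicator ?B x + sq_norm_wrt M (X x) / t) / 2)"
  proof (rule integral_mono)
    show "\<mu> \<bullet> (M *v X x) - clip d (M *v X x) \<bullet> \<mu>
        \<le> (t * a * indicator ?B x + sq_norm_wrt M (X x) / t) / 2" if "x \<in> space N" for x
      using clip_loss_bound[OF M d t, of \<mu> "X x"] that by (simp add: a_def indicator_def)
  qed (use int_Z int_c int_B Q in auto)
  also have "\<dots> = (t * a * measure N ?B + b / t) / 2"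
    using int_B Q B by (simp add: b_def)
  also have "\<dots> = (measure N ?B * b + a) / 2"
    using a b by (simp add: t_def field_simps)
  also have "\<dots> < a"
    using small by simp
  finally show ?thesis
    by simp
qed

theorem proposition1:
  fixes Y :: "(real ^ 'l) set"
    and \<Theta> :: "(real ^ 'k) set"
    and P :: "(real ^ 'l \<Rightarrow> real) set"
    and p :: "real ^ 'l \<Rightarrow> real"
    and f :: "real ^ 'l \<Rightarrow> real ^ 'k \<Rightarrow> real"
    and A S :: "real ^ 'k ^ 'k"
    and \<theta> :: "real ^ 'k"
    and d :: real
  assumes P_densities: "\<forall>q\<in>P. density_on Y q"
    and p_in_P: "p \<in> P"
    and model_densities: "\<forall>\<eta>\<in>\<Theta>. density_on Y (\<lambda>y. f y \<eta>)"
    and supports: "\<forall>q\<in>P. \<forall>\<eta>\<in>\<Theta>. density_support q \<subseteq> density_support (\<lambda>y. f y \<eta>)"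
    and pos_def: "pos_def_matrix (A ** S)"
    and Theta_open: "open \<Theta>"
    and Theta_convex: "convex \<Theta>"
    and theta_in: "\<theta> \<in> \<Theta>"
    and update_in: "AE y in law p. sd_rule (A ** S) f y \<theta> \<in> \<Theta>"
    and log_density_C2: "\<forall>x\<in>Y. C2_on \<Theta> (\<lambda>\<eta>. ln (f x \<eta>))"
    and score_finite: "\<forall>q\<in>P. \<forall>\<eta>\<in>\<Theta>. integrable (law q) (\<lambda>x. score f x \<eta>)"
    and increment_finite:
      "\<forall>q\<in>P. \<forall>\<eta>\<in>\<Theta>. integrable (law q) (\<lambda>y. (norm (increment (sd_rule (A ** S) f) y \<eta>))\<^sup>2)"
    and mean_nonzero: "score_mean f p \<theta> \<noteq> 0"
    and trace_finite: "score_cov_trace f p \<theta> < \<infinity>"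
    and d_pos: "d > 0"
    and d_large:
      "measure (law p) {y \<in> space (law p). norm ((A ** S) *v score f y \<theta>) > d}
         < sq_norm_wrt (A ** S) (score_mean f p \<theta>) /
           (sq_norm_wrt (A ** S) (score_mean f p \<theta>) + trace ((A ** S) ** score_cov f p \<theta>))"
  shows "(LINT y|law p. increment (csd_rule d (A ** S) f) y \<theta>) \<bullet> (LINT x|law p. score f x \<theta>) > 0"
proof -
  define M where "M = A ** S"
  define X where "X = (\<lambda>y. score f y \<theta>)"
  define \<mu> where "\<mu> = score_mean f p \<theta>"
  have M: "pos_def_matrix M"
    using pos_def by (simp add: M_def)
  have prob: "prob_space (law p)"
    using P_densities p_in_P by (simp add: density_on_def)
  have X: "integrable (law p) X"
    using score_finite p_in_P theta_in by (simp add: X_def)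
  have mu: "\<mu> = (LINT y|law p. X y)" "\<mu> \<noteq> 0"
    using mean_nonzero by (simp_all add: \<mu>_def X_def score_mean_def)
  have meas: "X \<in> borel_measurable (law p)"
    using X by simp
  have MX2: "integrable (law p) (\<lambda>y. (norm (M *v X y))\<^sup>2)"
    using increment_finite p_in_P theta_in
    by (simp add: increment_def sd_rule_def M_def X_def)
  obtain B where B: "B > 0" "\<And>v. B * norm v \<le> norm (M *v v)"
    using pos_def_bounded_below[OF M] by blast
  have X2: "integrable (law p) (\<lambda>y. (norm (X y))\<^sup>2)"
  proof (rule Bochner_Integration.integrable_bound)
    show "integrable (law p) (\<lambda>y. (norm (M *v X y))\<^sup>2 / B\<^sup>2)"
      using MX2 by simp
    have "(norm (X y))\<^sup>2 \<le> (norm (M *v X y))\<^sup>2 / B\<^sup>2" for y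
      using power_mono[OF B(2)[of "X y"], of 2] B(1)
      by (simp add: field_simps power_mult_distrib)
    then show "AE y in law p. norm ((norm (X y))\<^sup>2) \<le> norm ((norm (M *v X y))\<^sup>2 / B\<^sup>2)"
      by simp
  qed (use meas in measurable)
  have "(LINT y|law p. sq_norm_wrt M (X y)) = sq_norm_wrt M \<mu> + trace (M ** score_cov f p \<theta>)"
    using expectation_quadratic_form(2)[OF meas X2, of M \<mu>]
    by (simp add: score_cov_def \<mu>_def X_def)
  then have "(LINT y|law p. clip d (M *v X y)) \<bullet> \<mu> > 0"
    using clipped_mean_inner_pos[OF prob M d_pos X X2 mu] d_large
    by (simp add: M_def X_def \<mu>_def)
  then show ?thesis
    by (simp add: increment_def csd_rule_def sd_rule_def M_def X_def \<mu>_def score_mean_def)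
qed

end
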